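(* Let $k_{n-1},k_n>0$ be timesteps, $\tau=k_n/k_{n-1}$, let $\nu\in\mathbb{R}$ be the filter parameter, and let $y_{n-1},y_n,y_{n+1}^{old}\in\mathbb{R}$. Define the filtered value $$y_{n+1}^{new}=y_{n+1}^{old}-\frac{\nu}{2}\left\{\frac{2}{1+\tau}y_{n+1}^{old}-2y_n+\frac{2\tau}{1+\tau}y_{n-1}\right\}.$$ Let $\kappa^{old}$ and $\kappa^{new}$ be the discrete curvatures before and after filtering, i.e. the discrete curvatures at the points $(t_{n-1},y_{n-1}),(t_n,y_n),(t_{n+1},y_{n+1})$ with $y_{n+1}=y_{n+1}^{old}$ and $y_{n+1}=y_{n+1}^{new}$ respectively. Then the filter alters the discrete curvature by $$\kappa^{new}=\left(1-\frac{\nu}{1+\tau}\right)\kappa^{old}.$$ The filter reduces, without changing sign, the discrete curvature, $|\kappa^{new}|<|\kappa^{old}|$, provided $$0<\nu<1+\tau.$$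
   Context: Here $t_n=t_{n-1}+k_{n-1}$ and $t_{n+1}=t_n+k_n$. Let $\phi$ be the quadratic interpolant of the points $(t_{n-1},y_{n-1}),(t_n,y_n),(t_{n+1},y_{n+1})$. The discrete curvature at these three points is $$\kappa_n=k_{n-1}k_n\,\phi''=\frac{2k_{n-1}}{k_n+k_{n-1}}y_{n+1}-2y_n+\frac{2k_n}{k_n+k_{n-1}}y_{n-1}=\frac{2}{1+\tau}y_{n+1}-2y_n+\frac{2\tau}{1+\tau}y_{n-1}.$$
   Formalization: The strict inequality |κ^new| < |κ^old| is stated only when κ^old ≠ 0; for collinear points both curvatures are 0 and the strict inequality fails. *)

theory Defs
  imports Complex_Main "HOL-Computational_Algebra.Polynomial"
begin

(* Interpolant of degree at most 2: the second derivative may vanish (collinear points). *)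
definition interpolates_quadratically ::
    "real poly \<Rightarrow> real \<times> real \<Rightarrow> real \<times> real \<Rightarrow> real \<times> real \<Rightarrow> bool" where
  "interpolates_quadratically p P Q R \<longleftrightarrow>
     degree p \<le> 2 \<and> (\<forall>(t, y) \<in> {P, Q, R}. poly p t = y)"

definition quadratic_interpolant ::
    "real \<times> real \<Rightarrow> real \<times> real \<Rightarrow> real \<times> real \<Rightarrow> real poly" where
  "quadratic_interpolant P Q R = (THE p. interpolates_quadratically p P Q R)"

lemma ex1_interpolates_quadratically:
  assumes "fst P < fst Q" "fst Q < fst R"
  shows "\<exists>!p. interpolates_quadratically p P Q R"
proof -
  obtain t0 y0 t1 y1 t2 y2 where P: "P = (t0, y0)" and Q: "Q = (t1, y1)" and R: "R = (t2, y2)"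
    by (metis surj_pair)
  have lt: "t0 < t1" "t1 < t2" "t0 < t2" using assms P Q R by auto
  define p where "p =
     smult (y0 / ((t0 - t1) * (t0 - t2))) ([:- t1, 1:] * [:- t2, 1:])
   + smult (y1 / ((t1 - t0) * (t1 - t2))) ([:- t0, 1:] * [:- t2, 1:])
   + smult (y2 / ((t2 - t0) * (t2 - t1))) ([:- t0, 1:] * [:- t1, 1:])"
  have "degree p \<le> 2"
    unfolding p_def by (intro degree_add_le) (auto intro!: order.trans[OF degree_smult_le])
  moreover have "poly p t0 = y0" "poly p t1 = y1" "poly p t2 = y2"
    using lt by (simp_all add: p_def del: mult_pCons_left mult_pCons_right)
  ultimately have ex: "interpolates_quadratically p P Q R"
    by (simp add: interpolates_quadratically_def P Q R)
  have "q = p" if "interpolates_quadratically q P Q R" for q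
  proof (rule ccontr)
    assume "q \<noteq> p"
    define d where "d = q - p"
    have "d \<noteq> 0" "degree d \<le> 2" "poly d t0 = 0" "poly d t1 = 0" "poly d t2 = 0"
      using \<open>q \<noteq> p\<close> that ex
      by (auto simp: d_def interpolates_quadratically_def P Q R intro: degree_diff_le)
    then have "{t0, t1, t2} \<subseteq> {x. poly d x = 0}" "finite {x. poly d x = 0}"
      by (auto simp: poly_roots_finite)
    then have "card {t0, t1, t2} \<le> degree d"
      by (rule order.trans[OF card_mono[rotated] card_poly_roots_bound[OF \<open>d \<noteq> 0\<close>]])
    then show False using lt \<open>degree d \<le> 2\<close> by simp
  qed
  with ex show ?thesis by blast
qed

(* k_{n-1} * k_n * phi'', where the steps are the differences of the abscissae.  The second
   derivative of phi is constant, so the point at which it is evaluated is immaterial. *)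
definition discrete_curvature ::
    "real \<times> real \<Rightarrow> real \<times> real \<Rightarrow> real \<times> real \<Rightarrow> real" where
  "discrete_curvature P Q R =
     (fst Q - fst P) * (fst R - fst Q) * poly (pderiv (pderiv (quadratic_interpolant P Q R))) (fst Q)"

end

theory Submission
  imports Defs
begin

text \<open>
  The discrete curvature is a combination of the three ordinates in which the last one,
  \<open>y\<^sub>n\<^sub>+\<^sub>1\<close>, has the coefficient \<open>2 / (1 + \<tau>)\<close>, and the bracket in the filter is that same
  combination, evaluated at the unfiltered data.  The filter thus lowers \<open>y\<^sub>n\<^sub>+\<^sub>1\<close> by \<open>\<nu> / 2\<close> times
  the old curvature, and the curvature responds by dropping by
  \<open>2 / (1 + \<tau>) \<cdot> \<nu> / 2 = \<nu> / (1 + \<tau>)\<close> times itself.  For \<open>0 < \<nu> < 1 + \<tau>\<close> the remaining factor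
  \<open>1 - \<nu> / (1 + \<tau>)\<close> lies strictly between 0 and 1, so it keeps the sign and shrinks a nonzero magnitude.
  The expression of the curvature through the ordinates is \<open>discrete_curvature_eq_step_ratio\<close>.
\<close>

lemma interpolates_quadratic_interpolant:
  assumes "fst P < fst Q" "fst Q < fst R"
  shows "interpolates_quadratically (quadratic_interpolant P Q R) P Q R"
  unfolding quadratic_interpolant_def
  by (rule theI'[OF ex1_interpolates_quadratically[OF assms]])

lemma poly_degree_le_2_cases:
  fixes p :: "'a::zero poly"
  assumes "degree p \<le> 2"
  obtains a b c where "p = [:a, b, c:]"
proof
  show "p = [:coeff p 0, coeff p 1, coeff p 2:]"
    using assms
    by (intro poly_eqI) (auto simp: coeff_pCons coeff_eq_0 numeral_2_eq_2 split: nat.split)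
qed

text \<open>
  The weighted second difference on the right annihilates constants and linear functions and sends
  \<open>t\<^sup>2\<close> to \<open>2 h k\<close>, so on the values of a quadratic with leading coefficient \<open>c\<close> it gives
  \<open>h k (2 c)\<close>, which is the product of the steps and the second derivative.
\<close>
lemma discrete_curvature_eq_second_difference:
  fixes h k :: real
  assumes "h > 0" "k > 0"
  shows "discrete_curvature (t, y0) (t + h, y1) (t + h + k, y2) =
           2 * h / (k + h) * y2 - 2 * y1 + 2 * k / (k + h) * y0"
proof -
  define p where "p = quadratic_interpolant (t, y0) (t + h, y1) (t + h + k, y2)"
  have "interpolates_quadratically p (t, y0) (t + h, y1) (t + h + k, y2)"
    unfolding p_def by (rule interpolates_quadratic_interpolant) (use assms in auto)
  then have deg: "degree p \<le> 2"
    and vals: "poly p t = y0" "poly p (t + h) = y1" "poly p (t + h + k) = y2"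
    by (auto simp: interpolates_quadratically_def)
  obtain a b c where p: "p = [:a, b, c:]"
    using poly_degree_le_2_cases[OF deg] .
  have curv: "discrete_curvature (t, y0) (t + h, y1) (t + h + k, y2) = h * k * (2 * c)"
    by (simp add: discrete_curvature_def p_def[symmetric] p pderiv_pCons)
  have "(k + h) * (h * k * (2 * c)) = 2 * h * y2 - 2 * (k + h) * y1 + 2 * k * y0"
    unfolding vals[symmetric] p by (simp add: algebra_simps)
  with assms have "h * k * (2 * c) = (2 * h * y2 - 2 * (k + h) * y1 + 2 * k * y0) / (k + h)"
    by (simp add: field_simps)
  also have "\<dots> = 2 * h / (k + h) * y2 - 2 * y1 + 2 * k / (k + h) * y0"
    using assms by (simp add: add_divide_distrib diff_divide_distrib del: distrib_left_numeral)
  finally show ?thesis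
    unfolding curv .
qed

lemma discrete_curvature_eq_step_ratio:
  fixes h k :: real
  assumes "h > 0" "k > 0" and \<tau>: "\<tau> = k / h"
  shows "discrete_curvature (t, y0) (t + h, y1) (t + h + k, y2) =
           2 / (1 + \<tau>) * y2 - 2 * y1 + 2 * \<tau> / (1 + \<tau>) * y0"
proof -
  have "2 * h / (k + h) = 2 / (1 + \<tau>)" "2 * k / (k + h) = 2 * \<tau> / (1 + \<tau>)"
    using assms by (simp_all add: \<tau> field_simps)
  then show ?thesis
    using discrete_curvature_eq_second_difference[OF assms(1,2)] by simp
qed

lemma contraction_sgn_abs:
  fixes c x :: real
  assumes "0 < c" "c < 1"
  shows "sgn (c * x) = sgn x" and "x \<noteq> 0 \<Longrightarrow> \<bar>c * x\<bar> < \<bar>x\<bar>"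
  using assms by (simp_all add: sgn_mult abs_mult)

theorem proposition3p2:
  fixes t_prev t_cur t_next k_prev k_cur \<tau> \<nu> y_prev y_cur y_old y_new \<kappa>_old \<kappa>_new :: real
  assumes "k_prev > 0" and "k_cur > 0"
    and "t_cur = t_prev + k_prev" and "t_next = t_cur + k_cur"
    and "\<tau> = k_cur / k_prev"
    and "y_new = y_old - \<nu> / 2 *
           (2 / (1 + \<tau>) * y_old - 2 * y_cur + 2 * \<tau> / (1 + \<tau>) * y_prev)"
    and "\<kappa>_old = discrete_curvature (t_prev, y_prev) (t_cur, y_cur) (t_next, y_old)"
    and "\<kappa>_new = discrete_curvature (t_prev, y_prev) (t_cur, y_cur) (t_next, y_new)"
  shows "\<kappa>_new = (1 - \<nu> / (1 + \<tau>)) * \<kappa>_old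
       \<and> (0 < \<nu> \<and> \<nu> < 1 + \<tau> \<longrightarrow>
            sgn \<kappa>_new = sgn \<kappa>_old \<and> (\<kappa>_old \<noteq> 0 \<longrightarrow> \<bar>\<kappa>_new\<bar> < \<bar>\<kappa>_old\<bar>))"
proof -
  have "\<tau> > 0"
    using assms(1,2,5) by simp
  note curv = discrete_curvature_eq_step_ratio[OF assms(1,2,5), of t_prev y_prev y_cur,
      folded assms(3), folded assms(4)]
  have old: "\<kappa>_old = 2 / (1 + \<tau>) * y_old - 2 * y_cur + 2 * \<tau> / (1 + \<tau>) * y_prev"
    unfolding assms(7) by (rule curv)
  have shift: "y_new = y_old - \<nu> / 2 * \<kappa>_old"
    unfolding old by (rule assms(6))
  have "\<kappa>_new = 2 / (1 + \<tau>) * y_new - 2 * y_cur + 2 * \<tau> / (1 + \<tau>) * y_prev"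
    unfolding assms(8) by (rule curv)
  also have "\<dots> = \<kappa>_old - 2 / (1 + \<tau>) * (\<nu> / 2 * \<kappa>_old)"
    unfolding shift right_diff_distrib by (subst (2) old) (simp only: algebra_simps)
  also have "\<dots> = (1 - \<nu> / (1 + \<tau>)) * \<kappa>_old"
    using \<open>\<tau> > 0\<close> by (simp add: field_simps)
  finally have new: "\<kappa>_new = (1 - \<nu> / (1 + \<tau>)) * \<kappa>_old" .
  have "sgn \<kappa>_new = sgn \<kappa>_old \<and> (\<kappa>_old \<noteq> 0 \<longrightarrow> \<bar>\<kappa>_new\<bar> < \<bar>\<kappa>_old\<bar>)"
    if "0 < \<nu>" "\<nu> < 1 + \<tau>"
  proof -
    have "0 < 1 - \<nu> / (1 + \<tau>)" "1 - \<nu> / (1 + \<tau>) < 1"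
      using that \<open>\<tau> > 0\<close> by simp_all
    then show ?thesis
      unfolding new using contraction_sgn_abs by blast
  qed
  with new show ?thesis
    by blast
qed

end
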